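(* Let $k$ be a natural number and let $m\le\left\lfloor\frac k2\right\rfloor$ be a natural number ($m\ge1$). Let $P_1(x)=1$ and $P_m(x)=\prod_{j=2}^m\left(x-4\sin^2\left(\frac{j\pi}k\right)\right)$ for $m\ge2$. Define the polynomial $$\mathcal S_m(x)=\frac{P_m(x)-P_m\left(4\sin^2\left(\frac\pi k\right)\right)}{x-4\sin^2\left(\frac\pi k\right)}=\sum_{l=1}^{m-1}S_{m,l}\,x^{l-1}$$ (of degree $m-2$ for $m\ge2$, and zero for $m=1$) and $S_{m,0}=P_m\left(4\sin^2\left(\frac\pi k\right)\right)$. Suppose $z=(z_0,\dots,z_{k-1})\in\mathbb C^k$ satisfies $\sum_{\nu=0}^{k-1}z_\nu=0$. Then $$ 0\le S_{m,0}\left(\|\dot z\|^2-4\sin^2\left(\frac\pi k\right)\|z\|^2\right)+\sum_{l=1}^{m-1}S_{m,l}\left\|\tau z^{(l+1)}+4\sin^2\left(\frac\pi k\right)z^{(l-1)}\right\|^2 . $$ Equality holds if and only if the Fourier coefficients of $z$ satisfy $\zeta_\nu=0$ for $m<\nu<k-m$.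
   Context: $\|\cdot\|$ is the norm of the Hermitian inner product $\langle z,w\rangle=\sum_{\nu=0}^{k-1}z_\nu\overline{w_\nu}$ on $\mathbb C^k$. The derivative (first difference) of $z$ is $\dot z=(z_1-z_0,z_2-z_1,\dots,z_0-z_{k-1})$, and $z^{(j)}$ is its $j$-fold iterate ($z^{(0)}=z$). The cyclic shift is $\tau z=(z_{k-1},z_0,z_1,\dots,z_{k-2})$. The Fourier coefficients are $\zeta_\nu=\frac1k\sum_{j=0}^{k-1}z_j\,e^{-2\pi i\nu j/k}$, $0\le\nu\le k-1$. *)

theory Defs
  imports "Jordan_Normal_Form.Matrix" "HOL-Computational_Algebra.Polynomial"
begin

definition hnorm :: "complex vec \<Rightarrow> real" where
  "hnorm z = sqrt (Re (z \<bullet>c z))"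

text \<open>All indices of a vector of dimension k are read cyclically, i.e. modulo k.\<close>

definition cdiff :: "complex vec \<Rightarrow> complex vec" where
  "cdiff z = vec (dim_vec z) (\<lambda>i. z $ ((i + 1) mod dim_vec z) - z $ i)"

definition cdiff_iter :: "nat \<Rightarrow> complex vec \<Rightarrow> complex vec" where
  "cdiff_iter j z = (cdiff ^^ j) z"

text \<open>The shift moves the last entry to the front; adding the dimension before
  subtracting 1 avoids truncation at index 0.\<close>

definition cshift :: "complex vec \<Rightarrow> complex vec" where
  "cshift z = vec (dim_vec z) (\<lambda>i. z $ ((i + dim_vec z - 1) mod dim_vec z))"

definition fourier_coeff :: "complex vec \<Rightarrow> nat \<Rightarrow> complex" where
  "fourier_coeff z \<nu> = 1 / of_nat (dim_vec z) *
     (\<Sum>j<dim_vec z. z $ j * exp (- 2 * of_real pi * \<i> * of_nat \<nu> * of_nat j / of_nat (dim_vec z)))"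

definition eigval :: "nat \<Rightarrow> nat \<Rightarrow> real" where
  "eigval k j = 4 * (sin (real j * pi / real k))\<^sup>2"

definition P_poly :: "nat \<Rightarrow> nat \<Rightarrow> real poly" where
  "P_poly k m = (\<Prod>j=2..m. [:- eigval k j, 1:])"

text \<open>The division is exact, see \<open>S_poly_exact\<close> below.\<close>

definition S_poly :: "nat \<Rightarrow> nat \<Rightarrow> real poly" where
  "S_poly k m = (P_poly k m - [:poly (P_poly k m) (eigval k 1):]) div [:- eigval k 1, 1:]"

definition S_coeff :: "nat \<Rightarrow> nat \<Rightarrow> nat \<Rightarrow> real" where
  "S_coeff k m l = (if l = 0 then poly (P_poly k m) (eigval k 1) else coeff (S_poly k m) (l - 1))"

lemma S_poly_exact:
  "S_poly k m * [:- eigval k 1, 1:] = P_poly k m - [:poly (P_poly k m) (eigval k 1):]"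
proof -
  have "[:- eigval k 1, 1:] dvd P_poly k m - [:poly (P_poly k m) (eigval k 1):]"
    by (simp flip: poly_eq_0_iff_dvd)
  then show ?thesis
    unfolding S_poly_def by (rule dvd_div_mult_self)
qed

lemma S_poly_eq_quotient:
  assumes "x \<noteq> eigval k 1"
  shows "poly (S_poly k m) x
    = (poly (P_poly k m) x - poly (P_poly k m) (eigval k 1)) / (x - eigval k 1)"
proof -
  have "poly (S_poly k m * [:- eigval k 1, 1:]) x
      = poly (P_poly k m) x - poly (P_poly k m) (eigval k 1)"
    by (simp only: S_poly_exact) simp
  then show ?thesis
    using assms by (simp add: field_simps)
qed

lemma degree_P_poly: "degree (P_poly k m) = m - 1"
  unfolding P_poly_def by (subst degree_prod_eq_sum_degree) auto

lemma S_poly_1: "S_poly k 1 = 0"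
  by (simp add: S_poly_def P_poly_def pCons_one)

lemma degree_S_poly:
  assumes "m \<ge> 2"
  shows "S_poly k m \<noteq> 0 \<and> degree (S_poly k m) = m - 2"
proof -
  let ?c = "[:poly (P_poly k m) (eigval k 1):]"
  have "degree (P_poly k m - ?c) = degree (P_poly k m + - ?c)"
    by (simp only: diff_conv_add_uminus)
  also have "\<dots> = degree (P_poly k m)"
    by (rule degree_add_eq_left) (use assms in \<open>simp add: degree_P_poly\<close>)
  finally have d: "degree (P_poly k m - ?c) = m - 1"
    by (simp only: degree_P_poly)
  then have nz: "S_poly k m \<noteq> 0"
    using S_poly_exact[of k m] assms by auto
  then have "degree (S_poly k m) + 1 = m - 1"
    using d unfolding S_poly_exact[symmetric] by (subst (asm) degree_mult_eq) auto
  then show ?thesis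
    using nz by simp
qed

lemma S_poly_expansion:
  assumes "m \<ge> 1"
  shows "poly (S_poly k m) x = (\<Sum>l=1..m-1. S_coeff k m l * x ^ (l - 1))"
proof (cases "m = 1")
  case True
  then show ?thesis
    using S_poly_1[of k] by simp
next
  case False
  define n where "n = m - 2"
  with False assms have n: "m = Suc (Suc n)"
    by simp
  have "poly (S_poly k m) x = (\<Sum>i\<le>n. coeff (S_poly k m) i * x ^ i)"
    using degree_S_poly[of m k] by (simp add: n poly_altdef)
  also have "\<dots> = (\<Sum>l=1..Suc n. S_coeff k m l * x ^ (l - 1))"
    by (rule sum.reindex_bij_witness[of _ "\<lambda>l. l - 1" Suc]) (auto simp: S_coeff_def)
  finally show ?thesis
    by (simp add: n)
qed

end

theory Submission
  imports Defs
begin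

text \<open>
  The discrete Fourier transform diagonalises every operation in the statement. Write
  \<open>r\<close> for the root of unity \<open>exp (-2 \<pi> \<i> \<nu> / k)\<close> and \<open>\<lambda> \<nu>\<close> for \<open>4 sin\<^sup>2 (\<nu> \<pi> / k)\<close>. On the
  Fourier coefficient \<open>\<zeta> \<nu>\<close> the difference operator acts as multiplication by \<open>cnj r - 1\<close>, a
  number with squared modulus \<open>\<lambda> \<nu>\<close>, and the shift acts as multiplication by \<open>r\<close>. Since
  \<open>r (cnj r - 1)\<^sup>2 = r + cnj r - 2 = - \<lambda> \<nu>\<close>, the vector inside the \<open>l\<close>-th norm of the sum has the
  coefficients \<open>(cnj r - 1) ^ (l - 1) * (\<lambda> 1 - \<lambda> \<nu>) * \<zeta> \<nu>\<close>; the shift is there exactly to make the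
  middle factor real. With \<open>parseval\<close> this yields \<open>hnorm_cdiff_square\<close> and
  \<open>hnorm_shifted_difference_square\<close>.

  The expression in question is therefore \<open>k\<close> times the sum over \<open>\<nu>\<close> of \<open>\<bar>\<zeta> \<nu>\<bar>\<^sup>2\<close> times
  \<open>P (\<lambda> 1) * (\<lambda> \<nu> - \<lambda> 1) + S (\<lambda> \<nu>) * (\<lambda> \<nu> - \<lambda> 1)\<^sup>2\<close>, where \<open>P\<close> is the product polynomial and
  \<open>S\<close> its difference quotient at \<open>\<lambda> 1\<close>. This weight collapses to \<open>(\<lambda> \<nu> - \<lambda> 1) * P (\<lambda> \<nu>)\<close>, which is
  the product of \<open>\<lambda> \<nu> - \<lambda> j\<close> over \<open>1 \<le> j \<le> m\<close> (\<open>spectral_weight_conv_S_coeff\<close>).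

  Because \<open>\<lambda>\<close> is symmetric under \<open>\<nu> \<mapsto> k - \<nu>\<close> and increases up to \<open>k / 2\<close>, the weight is positive
  for \<open>m < \<nu> < k - m\<close> and vanishes at all other frequencies except \<open>\<nu> = 0\<close>
  (\<open>spectral_weight_pos\<close>, \<open>spectral_weight_eq_0\<close>). A vector with sum zero has no component at
  frequency \<open>0\<close>, so both the inequality and the equality case can be read off.
\<close>

section \<open>Characters of the cyclic group\<close>

definition unity_root :: "nat \<Rightarrow> nat \<Rightarrow> complex" where
  "unity_root k \<nu> = cis (- (2 * pi * real \<nu> / real k))"

lemma unity_root_power_dim:
  assumes "k > 0"
  shows "unity_root k \<nu> ^ k = 1"
proof -
  have "cis (2 * pi * real \<nu> / real k) ^ k = 1"
    using assms by (simp add: Complex.DeMoivre cis_multiple_2pi)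
  then show ?thesis
    by (simp add: unity_root_def flip: cis_cnj complex_cnj_power)
qed

lemma unity_root_power_mod: "k > 0 \<Longrightarrow> unity_root k \<nu> ^ (j mod k) = unity_root k \<nu> ^ j"
  by (metis unity_root_power_dim mult_div_mod_eq power_add power_mult power_one mult_1)

lemma unity_root_mult_cnj: "unity_root k \<nu> * cnj (unity_root k \<nu>) = 1"
  by (simp add: unity_root_def cis_cnj cis_mult)

lemma unity_root_power_swap: "unity_root k \<nu> ^ i = unity_root k i ^ \<nu>"
  by (simp add: unity_root_def Complex.DeMoivre mult_ac)

lemma unity_root_plus_cnj: "unity_root k \<nu> + cnj (unity_root k \<nu>) = of_real (2 - eigval k \<nu>)"
proof -
  have "cos (2 * pi * real \<nu> / real k) = 1 - 2 * (sin (real \<nu> * pi / real k))\<^sup>2"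
    using cos_double_sin[of "real \<nu> * pi / real k"] by (simp add: mult_ac)
  then show ?thesis
    by (simp add: unity_root_def eigval_def complex_eq_iff)
qed

lemma unity_root_cnj_diff_one_norm: "(cmod (cnj (unity_root k \<nu>) - 1))\<^sup>2 = eigval k \<nu>"
proof -
  let ?r = "unity_root k \<nu>"
  have "of_real ((cmod (cnj ?r - 1))\<^sup>2) = (cnj ?r - 1) * (?r - 1)"
    by (simp add: complex_norm_square del: of_real_power)
  also have "\<dots> = 2 - (?r + cnj ?r)"
    using unity_root_mult_cnj[of k \<nu>] by (simp add: algebra_simps)
  also have "\<dots> = of_real (eigval k \<nu>)"
    by (simp add: unity_root_plus_cnj)
  finally show ?thesis
    by (simp only: of_real_eq_iff)
qed

text \<open>A shift composed with a second difference is the symmetric second difference, hence the real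
  multiplier.\<close>

lemma unity_root_second_difference:
  "unity_root k \<nu> * (cnj (unity_root k \<nu>) - 1)\<^sup>2 = - of_real (eigval k \<nu>)"
proof -
  let ?r = "unity_root k \<nu>"
  have "?r * (cnj ?r - 1)\<^sup>2 = (?r * cnj ?r) * cnj ?r - 2 * (?r * cnj ?r) + ?r"
    by (simp add: power2_eq_square algebra_simps)
  also have "\<dots> = (?r + cnj ?r) - 2"
    by (simp add: unity_root_mult_cnj)
  finally show ?thesis
    by (simp add: unity_root_plus_cnj)
qed

lemma unity_root_inj:
  assumes "i < k" "j < k" "unity_root k i = unity_root k j"
  shows "i = j"
proof -
  have "cis (2 * pi * real i / real k) = cis (2 * pi * real j / real k)"
    using assms(3) by (simp add: unity_root_def flip: cis_cnj)
  moreover have "inj_on (\<lambda>i. cis (2 * pi * real i / real k)) {..<k}"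
    using assms(1) by (intro bij_betw_imp_inj_on[OF bij_betw_roots_unity]) simp
  ultimately show ?thesis
    using assms(1,2) by (auto dest: inj_onD)
qed

text \<open>Exchanging the roles of frequency and position turns the sum into a geometric series whose
  ratio is a \<open>k\<close>-th root of unity, equal to \<open>1\<close> only on the diagonal.\<close>

lemma unity_root_orthogonal:
  assumes "i < k" "j < k"
  shows "(\<Sum>\<nu><k. unity_root k \<nu> ^ i * cnj (unity_root k \<nu> ^ j)) = (if i = j then of_nat k else 0)"
proof -
  define q where "q = unity_root k i * cnj (unity_root k j)"
  have "(\<Sum>\<nu><k. unity_root k \<nu> ^ i * cnj (unity_root k \<nu> ^ j)) = (\<Sum>\<nu><k. q ^ \<nu>)"
    by (simp add: q_def unity_root_power_swap[of k _ i] unity_root_power_swap[of k _ j]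
        power_mult_distrib)
  also have "\<dots> = (if i = j then of_nat k else 0)"
  proof (cases "i = j")
    case True
    then show ?thesis
      by (simp add: q_def unity_root_mult_cnj)
  next
    case False
    have "q \<noteq> 1"
    proof
      assume "q = 1"
      have "unity_root k j = q * unity_root k j"
        using \<open>q = 1\<close> by simp
      also have "\<dots> = unity_root k i * (unity_root k j * cnj (unity_root k j))"
        by (simp add: q_def mult_ac)
      finally show False
        using False unity_root_inj[OF assms] by (simp add: unity_root_mult_cnj)
    qed
    moreover have "q ^ k = cnj (unity_root k j ^ k) * unity_root k i ^ k"
      by (simp add: q_def power_mult_distrib)
    then have "q ^ k = 1"
      using assms by (simp add: unity_root_power_dim)
    ultimately show ?thesis
      using False by (simp add: geometric_sum)
  qed
  finally show ?thesis .
qed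

section \<open>The discrete Fourier transform\<close>

lemma fourier_coeff_unity_root:
  "fourier_coeff z \<nu> = (\<Sum>j<dim_vec z. z $ j * unity_root (dim_vec z) \<nu> ^ j) / of_nat (dim_vec z)"
proof -
  have "exp (- 2 * of_real pi * \<i> * of_nat \<nu> * of_nat j / of_nat k) = unity_root k \<nu> ^ j" for j k
    by (simp add: unity_root_def cis_conv_exp mult_ac flip: exp_of_nat_mult)
  then show ?thesis
    by (simp add: fourier_coeff_def)
qed

lemma sum_cyclic_shift:
  fixes h :: "nat \<Rightarrow> 'a :: comm_monoid_add"
  shows "(\<Sum>i<k. h ((i + 1) mod k)) = (\<Sum>i<k. h i)"
proof (cases k)
  case (Suc n)
  have "(\<Sum>i<Suc n. h ((i + 1) mod Suc n)) = (\<Sum>i<n. h (Suc i)) + h 0"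
    by simp
  also have "\<dots> = (\<Sum>i<Suc n. h i)"
    by (simp only: sum.lessThan_Suc_shift add.commute)
  finally show ?thesis
    using Suc by simp
qed simp

lemma cdiff_carrier [simp]: "z \<in> carrier_vec k \<Longrightarrow> cdiff z \<in> carrier_vec k"
  by (auto simp: cdiff_def)

lemma cshift_carrier [simp]: "z \<in> carrier_vec k \<Longrightarrow> cshift z \<in> carrier_vec k"
  by (auto simp: cshift_def)

lemma cdiff_iter_carrier [simp]: "z \<in> carrier_vec k \<Longrightarrow> cdiff_iter l z \<in> carrier_vec k"
  by (induction l) (simp_all add: cdiff_iter_def)

lemma fourier_coeff_add:
  assumes "u \<in> carrier_vec k" "v \<in> carrier_vec k"
  shows "fourier_coeff (u + v) \<nu> = fourier_coeff u \<nu> + fourier_coeff v \<nu>"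
  using assms
  by (simp add: fourier_coeff_unity_root sum.distrib algebra_simps flip: add_divide_distrib)

lemma fourier_coeff_smult: "fourier_coeff (c \<cdot>\<^sub>v v) \<nu> = c * fourier_coeff v \<nu>"
  by (simp add: fourier_coeff_unity_root sum_distrib_left mult.assoc)

text \<open>Shifting the index forward costs one factor \<open>1 / r = cnj r\<close>. Taking the exponent of \<open>r\<close>
  modulo \<open>k\<close> as well makes the wrap-around term fit, so the sum is a cyclic rearrangement.\<close>

lemma fourier_coeff_cdiff:
  assumes "z \<in> carrier_vec k"
  shows "fourier_coeff (cdiff z) \<nu> = (cnj (unity_root k \<nu>) - 1) * fourier_coeff z \<nu>"
proof -
  let ?r = "unity_root k \<nu>"
  have dim: "dim_vec z = k"
    using assms by simp
  have "z $ ((j + 1) mod k) * ?r ^ j = cnj ?r * (z $ ((j + 1) mod k) * ?r ^ ((j + 1) mod k))"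
    if "j < k" for j
  proof -
    have "cnj ?r * ?r ^ ((j + 1) mod k) = (?r * cnj ?r) * ?r ^ j"
      using that by (subst unity_root_power_mod) (simp_all add: mult_ac)
    then show ?thesis
      by (simp add: unity_root_mult_cnj mult_ac)
  qed
  then have "(\<Sum>j<k. z $ ((j + 1) mod k) * ?r ^ j)
      = cnj ?r * (\<Sum>j<k. z $ ((j + 1) mod k) * ?r ^ ((j + 1) mod k))"
    unfolding sum_distrib_left by (intro sum.cong) simp_all
  also have "\<dots> = cnj ?r * (\<Sum>j<k. z $ j * ?r ^ j)"
    by (subst sum_cyclic_shift[of "\<lambda>j. z $ j * ?r ^ j"]) simp
  finally have "(\<Sum>j<k. cdiff z $ j * ?r ^ j) = (cnj ?r - 1) * (\<Sum>j<k. z $ j * ?r ^ j)"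
    by (simp add: cdiff_def dim left_diff_distrib sum_subtractf)
  then show ?thesis
    by (simp add: fourier_coeff_unity_root dim cdiff_def)
qed

lemma fourier_coeff_cdiff_iter:
  assumes "z \<in> carrier_vec k"
  shows "fourier_coeff (cdiff_iter l z) \<nu> = (cnj (unity_root k \<nu>) - 1) ^ l * fourier_coeff z \<nu>"
proof (induction l)
  case (Suc l)
  have "cdiff_iter (Suc l) z = cdiff (cdiff_iter l z)"
    by (simp add: cdiff_iter_def)
  then show ?case
    using Suc fourier_coeff_cdiff[OF cdiff_iter_carrier[OF assms]] by simp
qed (simp add: cdiff_iter_def)

lemma fourier_coeff_cshift:
  assumes "z \<in> carrier_vec k"
  shows "fourier_coeff (cshift z) \<nu> = unity_root k \<nu> * fourier_coeff z \<nu>"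
proof -
  let ?r = "unity_root k \<nu>"
  let ?h = "\<lambda>j. z $ ((j + k - 1) mod k) * ?r ^ j"
  have dim: "dim_vec z = k"
    using assms by simp
  have "?h ((j + 1) mod k) = ?r * (z $ j * ?r ^ j)" if "j < k" for j
  proof -
    have "((j + 1) mod k + k - 1) mod k = j"
      using that by (cases "j + 1 = k") auto
    moreover have "?r ^ ((j + 1) mod k) = ?r * ?r ^ j"
      using that by (subst unity_root_power_mod) simp_all
    ultimately show ?thesis
      by simp
  qed
  then have "(\<Sum>j<k. ?h ((j + 1) mod k)) = ?r * (\<Sum>j<k. z $ j * ?r ^ j)"
    by (simp add: sum_distrib_left)
  then have "(\<Sum>j<k. ?h j) = ?r * (\<Sum>j<k. z $ j * ?r ^ j)"
    by (simp only: sum_cyclic_shift[of ?h])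
  then show ?thesis
    by (simp add: fourier_coeff_unity_root dim cshift_def)
qed

lemma hnorm_square: "(hnorm z)\<^sup>2 = (\<Sum>j<dim_vec z. (cmod (z $ j))\<^sup>2)"
proof -
  have "Re (z \<bullet>c z) = (\<Sum>j<dim_vec z. (cmod (z $ j))\<^sup>2)"
    by (simp add: scalar_prod_def atLeast0LessThan complex_mult_cnj cmod_power2)
  then show ?thesis
    by (simp add: hnorm_def sum_nonneg)
qed

lemma parseval:
  assumes "z \<in> carrier_vec k" "k > 0"
  shows "(hnorm z)\<^sup>2 = real k * (\<Sum>\<nu><k. (cmod (fourier_coeff z \<nu>))\<^sup>2)"
proof -
  have dim: "dim_vec z = k"
    using assms by simp
  let ?F = "\<lambda>\<nu>. \<Sum>j<k. z $ j * unity_root k \<nu> ^ j"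
  have "(\<Sum>\<nu><k. complex_of_real ((cmod (?F \<nu>))\<^sup>2))
      = (\<Sum>\<nu><k. \<Sum>i<k. \<Sum>j<k. (z $ i * cnj (z $ j)) *
          (unity_root k \<nu> ^ i * cnj (unity_root k \<nu> ^ j)))"
    by (simp only: complex_norm_square sum_product cnj_sum complex_cnj_mult mult_ac)
  also have "\<dots> = (\<Sum>i<k. \<Sum>\<nu><k. \<Sum>j<k. (z $ i * cnj (z $ j)) *
          (unity_root k \<nu> ^ i * cnj (unity_root k \<nu> ^ j)))"
    by (rule sum.swap)
  also have "\<dots> = (\<Sum>i<k. \<Sum>j<k. \<Sum>\<nu><k. (z $ i * cnj (z $ j)) *
          (unity_root k \<nu> ^ i * cnj (unity_root k \<nu> ^ j)))"
    by (rule sum.cong[OF refl], rule sum.swap)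
  also have "\<dots> = (\<Sum>i<k. \<Sum>j<k. (z $ i * cnj (z $ j)) * (if i = j then of_nat k else 0))"
    by (simp add: unity_root_orthogonal flip: sum_distrib_left del: complex_cnj_power)
  also have "\<dots> = (\<Sum>i<k. of_nat k * (z $ i * cnj (z $ i)))"
    by (intro sum.cong refl) (simp add: if_distrib cong: if_cong)
  also have "\<dots> = complex_of_real (real k * (hnorm z)\<^sup>2)"
    by (simp add: hnorm_square dim complex_norm_square sum_distrib_left del: of_real_power)
  finally have "(\<Sum>\<nu><k. (cmod (?F \<nu>))\<^sup>2) = real k * (hnorm z)\<^sup>2"
    by (simp only: flip: of_real_sum) (simp only: of_real_eq_iff)
  moreover have "(\<Sum>\<nu><k. (cmod (fourier_coeff z \<nu>))\<^sup>2) = (\<Sum>\<nu><k. (cmod (?F \<nu>))\<^sup>2) / (real k)\<^sup>2"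
    by (simp add: fourier_coeff_unity_root dim norm_divide power_divide flip: sum_divide_distrib)
  ultimately show ?thesis
    using assms(2) by (simp add: power2_eq_square)
qed

section \<open>Sign of the spectral weight\<close>

lemma eigval_reflect: "\<nu> \<le> k \<Longrightarrow> eigval k (k - \<nu>) = eigval k \<nu>"
proof (cases "k = 0")
  case False
  assume "\<nu> \<le> k"
  then have "real (k - \<nu>) * pi / real k = pi - real \<nu> * pi / real k"
    using False by (simp add: of_nat_diff field_simps)
  then show ?thesis
    by (simp add: eigval_def)
qed simp

text \<open>Factoring the difference of squares of sines treats frequencies on both sides of \<open>k/2\<close>
  uniformly: the sum and the difference of the two angles lie strictly between \<open>0\<close> and \<open>\<pi>\<close>.\<close>

lemma eigval_less:
  assumes "j < \<nu>" "\<nu> + j < k"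
  shows "eigval k j < eigval k \<nu>"
proof -
  let ?a = "real \<nu> * pi / real k" and ?b = "real j * pi / real k"
  have k: "0 < real k"
    using assms by simp
  have "?a + ?b = (real \<nu> + real j) / real k * pi" "?a - ?b = (real \<nu> - real j) / real k * pi"
    using k by (simp_all add: field_simps)
  moreover have "0 < (real \<nu> + real j) / real k" "(real \<nu> + real j) / real k < 1"
    "0 < (real \<nu> - real j) / real k" "(real \<nu> - real j) / real k < 1"
    using assms k by simp_all
  ultimately have "0 < sin (?a + ?b)" "0 < sin (?a - ?b)"
    by (auto intro!: sin_gt_zero simp del: times_divide_eq_left)
  then have "0 < sin (?a + ?b) * sin (?a - ?b)"
    by simp
  also have "\<dots> = (sin ?a)\<^sup>2 * (cos ?b)\<^sup>2 - (cos ?a)\<^sup>2 * (sin ?b)\<^sup>2"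
    by (simp add: sin_add sin_diff power2_eq_square algebra_simps)
  also have "\<dots> = (sin ?a)\<^sup>2 - (sin ?b)\<^sup>2"
    by (simp add: cos_squared_eq algebra_simps)
  finally show ?thesis
    by (simp add: eigval_def)
qed

definition spectral_weight :: "nat \<Rightarrow> nat \<Rightarrow> nat \<Rightarrow> real" where
  "spectral_weight k m \<nu> = (\<Prod>j=1..m. eigval k \<nu> - eigval k j)"

lemma spectral_weight_pos:
  assumes "m < \<nu>" "\<nu> < k - m"
  shows "spectral_weight k m \<nu> > 0"
  unfolding spectral_weight_def using assms by (intro prod_pos) (auto intro!: eigval_less)

lemma spectral_weight_eq_0:
  assumes "0 < \<nu>" "\<nu> < k" "\<not> (m < \<nu> \<and> \<nu> < k - m)"
  shows "spectral_weight k m \<nu> = 0"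
proof -
  have "\<exists>j\<in>{1..m}. eigval k \<nu> = eigval k j"
  proof (cases "\<nu> \<le> m")
    case True
    then show ?thesis
      using assms by auto
  next
    case False
    \<comment> \<open>here \<open>k - m \<le> \<nu>\<close>, so the reflected frequency hits a zero\<close>
    then have "k - \<nu> \<in> {1..m}"
      using assms by auto
    then show ?thesis
      using eigval_reflect[of \<nu> k] assms(2) by (metis less_imp_le)
  qed
  then show ?thesis
    by (auto simp: spectral_weight_def)
qed

text \<open>This is the identity behind the choice of \<open>S_poly\<close>. One of the two factors \<open>d \<nu>\<close> in the square
  clears the denominator of the difference quotient, the constant left over cancels against the
  \<open>S_coeff k m 0\<close> term, and the other factor supplies the index \<open>j = 1\<close> that \<open>P_poly\<close> omits.\<close>

lemma spectral_weight_conv_S_coeff: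
  fixes k m \<nu> :: nat
  assumes "1 \<le> m"
  defines "d \<equiv> \<lambda>\<nu>. eigval k \<nu> - eigval k 1"
  shows "S_coeff k m 0 * d \<nu> + (\<Sum>l=1..m-1. S_coeff k m l * (eigval k \<nu> ^ (l - 1) * (d \<nu>)\<^sup>2))
    = spectral_weight k m \<nu>"
proof -
  let ?x = "eigval k \<nu>"
  have quotient: "poly (S_poly k m) ?x * d \<nu> = poly (P_poly k m) ?x - S_coeff k m 0"
    using arg_cong[OF S_poly_exact[of k m], of "\<lambda>p. poly p ?x"]
    by (simp add: d_def S_coeff_def algebra_simps)
  have "(\<Sum>l=1..m-1. S_coeff k m l * (?x ^ (l - 1) * (d \<nu>)\<^sup>2)) = poly (S_poly k m) ?x * (d \<nu>)\<^sup>2"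
    by (simp only: S_poly_expansion[OF assms(1)] sum_distrib_right mult.assoc)
  also have "\<dots> = (poly (P_poly k m) ?x - S_coeff k m 0) * d \<nu>"
    by (simp add: power2_eq_square flip: quotient)
  finally have "S_coeff k m 0 * d \<nu> + (\<Sum>l=1..m-1. S_coeff k m l * (?x ^ (l - 1) * (d \<nu>)\<^sup>2))
      = d \<nu> * poly (P_poly k m) ?x"
    by (simp add: algebra_simps)
  also have "\<dots> = spectral_weight k m \<nu>"
    using assms(1)
    by (simp add: d_def P_poly_def poly_prod spectral_weight_def prod.atLeast_Suc_atMost
        numeral_2_eq_2)
  finally show ?thesis .
qed

section \<open>The inequality\<close>

lemma hnorm_cdiff_square:
  assumes "z \<in> carrier_vec k" "k > 0"
  shows "(hnorm (cdiff z))\<^sup>2 = real k * (\<Sum>\<nu><k. eigval k \<nu> * (cmod (fourier_coeff z \<nu>))\<^sup>2)"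
  using assms
  by (simp add: parseval[of _ k] fourier_coeff_cdiff norm_mult power_mult_distrib
      unity_root_cnj_diff_one_norm)

text \<open>Shift and two of the \<open>l + 1\<close> differences combine to the real multiplier \<open>- eigval k \<nu>\<close>, leaving
  \<open>l - 1\<close> differences in common with the second summand; so the two summands add to a single real
  multiple of \<open>(cnj r - 1) ^ (l - 1) * \<zeta> \<nu>\<close> at each frequency.\<close>

lemma hnorm_shifted_difference_square:
  assumes z: "z \<in> carrier_vec k" and k: "k > 0" and l: "l \<ge> 1"
  shows "(hnorm (cshift (cdiff_iter (l + 1) z) + of_real c \<cdot>\<^sub>v cdiff_iter (l - 1) z))\<^sup>2
    = real k * (\<Sum>\<nu><k. eigval k \<nu> ^ (l - 1) * (eigval k \<nu> - c)\<^sup>2 * (cmod (fourier_coeff z \<nu>))\<^sup>2)"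
    (is "(hnorm ?v)\<^sup>2 = _")
proof -
  have "(cmod (fourier_coeff ?v \<nu>))\<^sup>2
      = eigval k \<nu> ^ (l - 1) * (eigval k \<nu> - c)\<^sup>2 * (cmod (fourier_coeff z \<nu>))\<^sup>2" for \<nu>
  proof -
    let ?r = "unity_root k \<nu>"
    let ?s = "cnj ?r - 1"
    have "l + 1 = (l - 1) + 2"
      using l by simp
    then have pow: "?s ^ (l + 1) = ?s ^ (l - 1) * ?s\<^sup>2"
      by (simp only: power_add)
    have "fourier_coeff ?v \<nu>
        = ?r * (?s ^ (l + 1) * fourier_coeff z \<nu>) + of_real c * (?s ^ (l - 1) * fourier_coeff z \<nu>)"
      using z by (simp add: fourier_coeff_add[of _ k] fourier_coeff_smult fourier_coeff_cshift[of _ k]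
          fourier_coeff_cdiff_iter[of _ k] del: power_Suc)
    also have "\<dots> = ?s ^ (l - 1) * (?r * ?s\<^sup>2 + of_real c) * fourier_coeff z \<nu>"
      by (simp only: pow) (simp add: algebra_simps)
    also have "?r * ?s\<^sup>2 + of_real c = of_real (c - eigval k \<nu>)"
      by (simp add: unity_root_second_difference)
    finally have "(cmod (fourier_coeff ?v \<nu>))\<^sup>2
        = (cmod ?s ^ (l - 1))\<^sup>2 * (c - eigval k \<nu>)\<^sup>2 * (cmod (fourier_coeff z \<nu>))\<^sup>2"
      by (simp only: norm_mult norm_power norm_of_real power_mult_distrib power2_abs)
    also have "(cmod ?s ^ (l - 1))\<^sup>2 = eigval k \<nu> ^ (l - 1)"
      by (simp only: power_mult[symmetric] mult.commute[of _ 2])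
        (simp only: power_mult unity_root_cnj_diff_one_norm)
    finally show ?thesis
      by (simp only: power2_commute)
  qed
  then show ?thesis
    using z k by (simp add: parseval[of _ k])
qed

theorem proposition3:
  fixes k m :: nat and z :: "complex vec"
  assumes "1 \<le> m" and "m \<le> k div 2"
    and "z \<in> carrier_vec k"
    and "(\<Sum>\<nu><k. z $ \<nu>) = 0"
  shows "let E = S_coeff k m 0 * ((hnorm (cdiff z))\<^sup>2 - 4 * (sin (pi / real k))\<^sup>2 * (hnorm z)\<^sup>2)
                + (\<Sum>l=1..m-1. S_coeff k m l *
                    (hnorm (cshift (cdiff_iter (l + 1) z)
                       + of_real (4 * (sin (pi / real k))\<^sup>2) \<cdot>\<^sub>v cdiff_iter (l - 1) z))\<^sup>2)
         in 0 \<le> E \<and> (0 = E \<longleftrightarrow> (\<forall>\<nu>. m < \<nu> \<and> \<nu> < k - m \<longrightarrow> fourier_coeff z \<nu> = 0))"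
proof -
  define a where "a \<nu> = (cmod (fourier_coeff z \<nu>))\<^sup>2" for \<nu>
  define W where "W = (\<Sum>\<nu><k. spectral_weight k m \<nu> * a \<nu>)"
  let ?e = "eigval k 1"
  have k: "k > 0"
    using assms(1,2) by (cases k) auto
  have e: "4 * (sin (pi / real k))\<^sup>2 = ?e"
    by (simp add: eigval_def)
  have "S_coeff k m 0 * ((hnorm (cdiff z))\<^sup>2 - ?e * (hnorm z)\<^sup>2)
      = real k * (\<Sum>\<nu><k. S_coeff k m 0 * (eigval k \<nu> - ?e) * a \<nu>)"
    using assms(3) k
    by (simp add: hnorm_cdiff_square parseval[of z k] a_def sum_distrib_left sum_subtractf
        algebra_simps)
  moreover have "(\<Sum>l=1..m-1. S_coeff k m l *
        (hnorm (cshift (cdiff_iter (l + 1) z) + of_real ?e \<cdot>\<^sub>v cdiff_iter (l - 1) z))\<^sup>2)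
      = real k * (\<Sum>\<nu><k. (\<Sum>l=1..m-1. S_coeff k m l *
          (eigval k \<nu> ^ (l - 1) * (eigval k \<nu> - ?e)\<^sup>2)) * a \<nu>)" (is "?T = _")
  proof -
    have "?T = (\<Sum>l=1..m-1. \<Sum>\<nu><k. real k * (S_coeff k m l *
          (eigval k \<nu> ^ (l - 1) * (eigval k \<nu> - ?e)\<^sup>2) * a \<nu>))"
      by (rule sum.cong[OF refl], subst hnorm_shifted_difference_square[OF assms(3) k])
        (auto simp: a_def sum_distrib_left mult_ac)
    also have "\<dots> = (\<Sum>\<nu><k. \<Sum>l=1..m-1. real k * (S_coeff k m l *
          (eigval k \<nu> ^ (l - 1) * (eigval k \<nu> - ?e)\<^sup>2) * a \<nu>))"
      by (rule sum.swap)
    finally show ?thesis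
      by (simp only: sum_distrib_left sum_distrib_right)
  qed
  ultimately have E: "S_coeff k m 0 * ((hnorm (cdiff z))\<^sup>2 - ?e * (hnorm z)\<^sup>2) + ?T = real k * W"
    by (simp only: W_def distrib_left[symmetric] sum.distrib[symmetric] distrib_right[symmetric]
        spectral_weight_conv_S_coeff[OF assms(1)])
  have "fourier_coeff z 0 = 0"
    using assms(3,4) by (simp add: fourier_coeff_def)
  then have "spectral_weight k m \<nu> * a \<nu> = 0" if "\<nu> < k" "\<not> (m < \<nu> \<and> \<nu> < k - m)" for \<nu>
    using that spectral_weight_eq_0[of \<nu> k m] by (cases "\<nu> = 0") (simp_all add: a_def)
  then have W: "W = (\<Sum>\<nu>\<in>{m<..<k - m}. spectral_weight k m \<nu> * a \<nu>)"
    unfolding W_def by (intro sum.mono_neutral_right) auto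
  have nonneg: "0 \<le> spectral_weight k m \<nu> * a \<nu>" if "\<nu> \<in> {m<..<k - m}" for \<nu>
    using that spectral_weight_pos[of m \<nu> k] by (simp add: a_def)
  have "W = 0 \<longleftrightarrow> (\<forall>\<nu>\<in>{m<..<k - m}. spectral_weight k m \<nu> * a \<nu> = 0)"
    unfolding W by (rule sum_nonneg_eq_0_iff) (simp_all add: nonneg)
  also have "\<dots> \<longleftrightarrow> (\<forall>\<nu>. m < \<nu> \<and> \<nu> < k - m \<longrightarrow> fourier_coeff z \<nu> = 0)"
    using spectral_weight_pos[of m _ k] by (force simp: a_def)
  finally have "W = 0 \<longleftrightarrow> (\<forall>\<nu>. m < \<nu> \<and> \<nu> < k - m \<longrightarrow> fourier_coeff z \<nu> = 0)" .
  moreover have "0 \<le> W"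
    unfolding W by (rule sum_nonneg) (rule nonneg)
  ultimately show ?thesis
    unfolding Let_def e E using k by auto
qed

end
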